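(* Let $X$ and $Y$ be two non-negative random variables with differentiable quantile functions $F^{-1}$ and $G^{-1}$ and density functions $f$ and $g$, respectively. Assume that the ratio $p\mapsto f(F^{-1}(p))/g(G^{-1}(p))$ on $(0,1)$ has $n$ modes (with $n\ge1$ finite), located at $0<p_1<p_2<\cdots<p_n<1$, and that the ratio is initially increasing (so it is increasing on $(0,p_1)$, decreasing on $(p_1,p_2)$, and so on alternately, up to $(p_n,1)$). Define $$\delta(p)=F^{-1}(p)\,\frac{f(F^{-1}(p))}{g(G^{-1}(p))}-G^{-1}(p),\qquad p\in(0,1).$$ Then $X\le_{\star}Y$ if, and only if, one of the following sets of conditions is satisfied: (a) $n=2m$, $\lim_{p\to0^+}\delta(p)\ge0$ and $\delta(p_{2i})\ge0$ for $i=1,\dots,m$; (b) $n=2m+1$, $\lim_{p\to0^+}\delta(p)\ge0$, $\delta(p_{2i})\ge0$ for $i=1,\dots,m$, and $\lim_{p\to1^-}\delta(p)\ge0$. Similarly, $X\ge_{\star}Y$ if, and only if, one of the following sets of conditions is satisfied: (c) $n=2m$, $\lim_{p\to1^-}\delta(p)\le0$ and $\delta(p_{2i-1})\le0$ for $i=1,\dots,m$; (d) $n=2m+1$ and $\delta(p_{2i-1})\le0$ for $i=1,\dots,m+1$.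
   Context: Standing assumptions: $X$ and $Y$ are non-negative, have finite expectation, distribution functions $F$ and $G$, density functions $f$ and $g$, and interval supports $(l_X,u_X)$ and $(l_Y,u_Y)$ (bounded or unbounded). The quantile function is $F^{-1}(p)=\inf\{x\in\mathbb R: F(x)\ge p\}$, $p\in(0,1)$, and similarly for $G^{-1}$; quantile functions are differentiable on $(0,1)$ with $\frac{d}{dp}F^{-1}(p)=1/f(F^{-1}(p))$ and $\frac{d}{dp}G^{-1}(p)=1/g(G^{-1}(p))$. "Increasing" and "decreasing" are used in the non-strict sense. A mode of a function means a relative extreme (maximum or minimum), i.e. a point at which the function changes from increasing to decreasing or from decreasing to increasing. Limits are taken in the extended reals. Star-shaped order: $X\le_\star Y$ means that $G^{-1}(p)/F^{-1}(p)$ is increasing in $p\in(0,1)$; $X\ge_\star Y$ means $Y\le_\star X$. *)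

theory Defs
  imports "HOL-Probability.Probability"
begin

definition quantile :: "'a measure \<Rightarrow> ('a \<Rightarrow> real) \<Rightarrow> real \<Rightarrow> real" where
  "quantile M X p = Inf {x. p \<le> cdf (distr M borel X) x}"

definition dist_support :: "'a measure \<Rightarrow> ('a \<Rightarrow> real) \<Rightarrow> real set" where
  "dist_support M X = {x. \<forall>U. open U \<longrightarrow> x \<in> U \<longrightarrow> 0 < measure (distr M borel X) U}"

text \<open>
  The topological support is closed, so "interval support (l, u)" is expressed by saying that
  the support is the closure of the open interval, which may be unbounded.

  The identity for the derivative of the quantile function tacitly says that 1 / f is finite
  there. As 1 / 0 = 0 in HOL, positivity of the density at the quantiles has to be stated.
\<close>

locale nonneg_random_variable = prob_space M
  for M :: "'a measure" and X :: "'a \<Rightarrow> real" and f :: "real \<Rightarrow> real" and l u :: ereal +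
  assumes nonneg: "AE x in M. 0 \<le> X x"
    and finite_expectation: "integrable M X"
    and density_nonneg: "\<And>x. 0 \<le> f x"
    and density: "distributed M lborel X (\<lambda>x. ennreal (f x))"
    and interval_nonempty: "l < u"
    and interval_support: "dist_support M X = closure (einterval l u)"
    and density_quantile_pos: "\<And>p. p \<in> {0<..<1} \<Longrightarrow> 0 < f (quantile M X p)"
    and quantile_derivative: "\<And>p. p \<in> {0<..<1} \<Longrightarrow>
      (quantile M X has_real_derivative 1 / f (quantile M X p)) (at p)"

definition star_le ::
  "'a measure \<Rightarrow> ('a \<Rightarrow> real) \<Rightarrow> 'b measure \<Rightarrow> ('b \<Rightarrow> real) \<Rightarrow> bool" where
  "star_le M X N Y \<longleftrightarrow> mono_on {0<..<1} (\<lambda>p. quantile N Y p / quantile M X p)"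

definition density_quantile_ratio ::
  "'a measure \<Rightarrow> ('a \<Rightarrow> real) \<Rightarrow> (real \<Rightarrow> real) \<Rightarrow>
   'b measure \<Rightarrow> ('b \<Rightarrow> real) \<Rightarrow> (real \<Rightarrow> real) \<Rightarrow> real \<Rightarrow> real" where
  "density_quantile_ratio M X f N Y g p = f (quantile M X p) / g (quantile N Y p)"

definition delta ::
  "'a measure \<Rightarrow> ('a \<Rightarrow> real) \<Rightarrow> (real \<Rightarrow> real) \<Rightarrow>
   'b measure \<Rightarrow> ('b \<Rightarrow> real) \<Rightarrow> (real \<Rightarrow> real) \<Rightarrow> real \<Rightarrow> real" where
  "delta M X f N Y g p =
     quantile M X p * density_quantile_ratio M X f N Y g p - quantile N Y p"

definition is_mode :: "(real \<Rightarrow> real) \<Rightarrow> real \<Rightarrow> bool" where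
  "is_mode r q \<longleftrightarrow> (\<exists>a b. a < q \<and> q < b \<and>
     (mono_on {a<..q} r \<and> antimono_on {q..<b} r \<or>
      antimono_on {a<..q} r \<and> mono_on {q..<b} r))"

definition breakpoint :: "nat \<Rightarrow> (nat \<Rightarrow> real) \<Rightarrow> nat \<Rightarrow> real" where
  "breakpoint n p i = (if i = 0 then 0 else if i \<le> n then p i else 1)"

text \<open>
  The modes are p 1, ..., p n, and r alternates on the n + 1 open intervals they cut out of
  (0, 1), starting with increasing. Monotonicity is non-strict, so flat stretches are allowed
  and a mode may be placed anywhere on a flat extreme.
\<close>

definition has_modes_initially_increasing ::
  "(real \<Rightarrow> real) \<Rightarrow> nat \<Rightarrow> (nat \<Rightarrow> real) \<Rightarrow> bool" where
  "has_modes_initially_increasing r n p \<longleftrightarrow>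
     strict_mono_on {1..n} p \<and> p ` {1..n} \<subseteq> {0<..<1} \<and>
     (\<forall>i\<in>{1..n}. is_mode r (p i)) \<and>
     (\<forall>i\<le>n. if even i then mono_on {breakpoint n p i<..<breakpoint n p (Suc i)} r
            else antimono_on {breakpoint n p i<..<breakpoint n p (Suc i)} r)"

end

theory Submission
  imports Defs
begin

text \<open>
  Write \<open>A\<close>, \<open>B\<close> for the two quantile functions and \<open>r = B' / A'\<close> for the density-quantile ratio.
  The derivative of \<open>B / A\<close> is \<open>A' * \<delta> / A^2\<close> with \<open>\<delta> = A * r - B\<close>, so both star-shaped orders are
  statements about the sign of \<open>\<delta>\<close>. As \<open>d\<delta> = A dr\<close> with \<open>A > 0\<close>, \<open>\<delta>\<close> increases and decreases
  together with \<open>r\<close>, so its sign is decided at its alternating extremes and in the limits at the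
  ends of the interval.
\<close>

section \<open>Calculus: monotone quotients and the variation of \<open>A * r - B\<close>\<close>

text \<open>By the quotient rule the derivative has the sign of its numerator. The cross-multiplied
  criterion serves both star-shaped orders, with the roles of \<open>A\<close> and \<open>B\<close>
  exchanged for the second.\<close>

lemma mono_on_divide_iff:
  fixes A B a b :: "real \<Rightarrow> real"
  assumes A: "\<And>t. t \<in> {u<..<v} \<Longrightarrow> (A has_real_derivative a t) (at t)"
    and B: "\<And>t. t \<in> {u<..<v} \<Longrightarrow> (B has_real_derivative b t) (at t)"
    and pos: "\<And>t. t \<in> {u<..<v} \<Longrightarrow> 0 < A t"
  shows "mono_on {u<..<v} (\<lambda>t. B t / A t) \<longleftrightarrow> (\<forall>t\<in>{u<..<v}. B t * a t \<le> A t * b t)"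
proof -
  have D: "((\<lambda>t. B t / A t) has_real_derivative (A t * b t - B t * a t) / (A t)\<^sup>2) (at t)"
    if "t \<in> {u<..<v}" for t
    using A[OF that] B[OF that] pos[OF that]
    by (auto intro!: derivative_eq_intros simp: field_simps power2_eq_square)
  show ?thesis
  proof (intro iffI ballI mono_onI)
    fix t assume mono: "mono_on {u<..<v} (\<lambda>t. B t / A t)" and t: "t \<in> {u<..<v}"
    have "0 \<le> (A t * b t - B t * a t) / (A t)\<^sup>2"
      using mono_on_imp_deriv_nonneg[OF mono D[OF t]] t by simp
    then show "B t * a t \<le> A t * b t"
      using pos[OF t] by (simp add: zero_le_divide_iff)
  next
    fix s t assume le: "\<forall>t\<in>{u<..<v}. B t * a t \<le> A t * b t"
      and st: "s \<in> {u<..<v}" "t \<in> {u<..<v}" "s \<le> t"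
    show "B s / A s \<le> B t / A t"
    proof (rule DERIV_nonneg_imp_nondecreasing[OF \<open>s \<le> t\<close>])
      fix z assume "s \<le> z" "z \<le> t"
      then have z: "z \<in> {u<..<v}" using st by auto
      with le show "\<exists>w. ((\<lambda>t. B t / A t) has_real_derivative w) (at z) \<and> 0 \<le> w"
        by (intro exI[of _ "(A z * b z - B z * a z) / (A z)\<^sup>2"] conjI D) auto
    qed
  qed
qed

text \<open>
  No continuity of \<open>r\<close> is assumed: since \<open>a * r\<close> is a derivative, monotonicity on the open
  interval carries over to the end points.
\<close>

lemma delta_le_of_mono_on:
  fixes A B a r :: "real \<Rightarrow> real"
  assumes "x < y"
    and A: "\<And>t. t \<in> {x..y} \<Longrightarrow> (A has_real_derivative a t) (at t)"
    and B: "\<And>t. t \<in> {x..y} \<Longrightarrow> (B has_real_derivative a t * r t) (at t)"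
    and a: "\<And>t. t \<in> {x..y} \<Longrightarrow> 0 < a t"
    and nonneg: "0 \<le> A x"
    and mono: "mono_on {x<..<y} r"
  shows "A x * r x - B x \<le> A y * r y - B y"
proof -
  \<comment> \<open>Tilting \<open>B\<close> by a constant slope \<open>k\<close> makes the sign of
    the derivative compare \<open>r\<close> with \<open>k\<close>. The slopes used below are the
    values \<open>r c\<close> and \<open>r y\<close>.\<close>
  have D: "((\<lambda>t. B t - k * A t) has_real_derivative a t * (r t - k)) (at t)"
    if "t \<in> {x..y}" for t k
    using A[OF that] B[OF that] by (auto intro!: derivative_eq_intros simp: algebra_simps)
  have up: "B s - k * A s \<le> B t - k * A t"
    if "x \<le> s" "s \<le> t" "t \<le> y" "\<And>z. s < z \<Longrightarrow> z < t \<Longrightarrow> k \<le> r z" for s t k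
  proof (rule DERIV_nonneg_imp_increasing_open[OF \<open>s \<le> t\<close>])
    show "\<exists>w. ((\<lambda>t. B t - k * A t) has_real_derivative w) (at z) \<and> 0 \<le> w"
      if "s < z" "z < t" for z
      using that \<open>x \<le> s\<close> \<open>t \<le> y\<close> \<open>\<And>z. s < z \<Longrightarrow> z < t \<Longrightarrow> k \<le> r z\<close>[of z] a[of z]
      by (intro exI[of _ "a z * (r z - k)"] conjI D) auto
    show "continuous_on {s..t} (\<lambda>t. B t - k * A t)"
      by (rule DERIV_continuous_on[OF DERIV_subset[OF D subset_UNIV]]) (use that in auto)
  qed
  have down: "B t - k * A t \<le> B s - k * A s"
    if "x \<le> s" "s \<le> t" "t \<le> y" "\<And>z. s < z \<Longrightarrow> z < t \<Longrightarrow> r z \<le> k" for s t k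
  proof (rule DERIV_nonpos_imp_decreasing_open[OF \<open>s \<le> t\<close>])
    show "\<exists>w. ((\<lambda>t. B t - k * A t) has_real_derivative w) (at z) \<and> w \<le> 0"
      if "s < z" "z < t" for z
      using that \<open>x \<le> s\<close> \<open>t \<le> y\<close> \<open>\<And>z. s < z \<Longrightarrow> z < t \<Longrightarrow> r z \<le> k\<close>[of z] a[of z]
      by (intro exI[of _ "a z * (r z - k)"] conjI D) (auto simp: mult_le_0_iff)
    show "continuous_on {s..t} (\<lambda>t. B t - k * A t)"
      by (rule DERIV_continuous_on[OF DERIV_subset[OF D subset_UNIV]]) (use that in auto)
  qed
  \<comment> \<open>If \<open>r y\<close> were below \<open>r c\<close>, the tilt by
    \<open>k = r c\<close> would have negative derivative at \<open>y\<close>, hence strictly larger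
    values just to the left of \<open>y\<close>. But \<open>r\<close> is at least \<open>r c\<close>
    on \<open>(c, y)\<close>, so \<open>up\<close> makes this tilt nondecreasing there. The claim
    \<open>left\<close> is the mirror image at \<open>x\<close>, using \<open>down\<close>.\<close>
  have right: "r c \<le> r y" if c: "x < c" "c < y" for c
  proof (rule ccontr)
    assume "\<not> r c \<le> r y"
    then have "a y * (r y - r c) < 0"
      using a[of y] \<open>x < y\<close> by (simp add: mult_less_0_iff)
    then obtain d where d: "0 < d"
      "\<And>h. 0 < h \<Longrightarrow> h < d \<Longrightarrow> B y - r c * A y < B (y - h) - r c * A (y - h)"
      using DERIV_neg_dec_left[OF D[of y "r c"]] \<open>x < y\<close> by auto
    \<comment> \<open>The bound \<open>d / 2\<close> keeps \<open>h\<close> within the range of the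
      strict inequality; \<open>y - c\<close> keeps \<open>y - h\<close> to the right of
      \<open>c\<close>, where \<open>up\<close> applies.\<close>
    define h where "h = min (d / 2) (y - c)"
    have h: "0 < h" "h < d" "c \<le> y - h" using d(1) c by (auto simp: h_def)
    have "B (y - h) - r c * A (y - h) \<le> B y - r c * A y"
      using c h by (intro up) (auto intro!: mono_onD[OF mono])
    then show False using d(2)[OF h(1,2)] by simp
  qed
  have left: "r x \<le> r c" if c: "x < c" "c < y" for c
  proof (rule ccontr)
    assume "\<not> r x \<le> r c"
    then have "0 < a x * (r x - r c)"
      using a[of x] \<open>x < y\<close> by simp
    then obtain d where d: "0 < d"
      "\<And>h. 0 < h \<Longrightarrow> h < d \<Longrightarrow> B x - r c * A x < B (x + h) - r c * A (x + h)"
      using DERIV_pos_inc_right[OF D[of x "r c"]] \<open>x < y\<close> by auto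
    define h where "h = min (d / 2) (c - x)"
    have h: "0 < h" "h < d" "x + h \<le> c" using d(1) c by (auto simp: h_def)
    have "B (x + h) - r c * A (x + h) \<le> B x - r c * A x"
      using c h by (intro down) (auto intro!: mono_onD[OF mono])
    then show False using d(2)[OF h(1,2)] by simp
  qed
  obtain c where c: "x < c" "c < y" using dense[OF \<open>x < y\<close>] by blast
  \<comment> \<open>The increment of \<open>A * r - B\<close> splits as
    \<open>A x * (r y - r x)\<close> plus the decrease from \<open>x\<close> to \<open>y\<close> of
    the tilt by \<open>k = r y\<close>. Both parts are nonnegative.\<close>
  have "A x * r x \<le> A x * r y"
    using left[OF c] right[OF c] nonneg by (intro mult_left_mono) auto
  moreover have "B y - r y * A y \<le> B x - r y * A x"
    using \<open>x < y\<close> right by (intro down) auto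
  ultimately show ?thesis by (simp add: algebra_simps)
qed

text \<open>Negating both \<open>B\<close> and \<open>r\<close> preserves the relation between the
  derivatives and reduces this to the increasing case.\<close>

lemma delta_ge_of_antimono_on:
  fixes A B a r :: "real \<Rightarrow> real"
  assumes "x < y"
    and "\<And>t. t \<in> {x..y} \<Longrightarrow> (A has_real_derivative a t) (at t)"
    and "\<And>t. t \<in> {x..y} \<Longrightarrow> (B has_real_derivative a t * r t) (at t)"
    and "\<And>t. t \<in> {x..y} \<Longrightarrow> 0 < a t"
    and "0 \<le> A x"
    and "antimono_on {x<..<y} r"
  shows "A y * r y - B y \<le> A x * r x - B x"
proof -
  have "mono_on {x<..<y} (\<lambda>t. - r t)"
    using assms(6) by (auto simp: monotone_on_def)
  then have "A x * - r x - - B x \<le> A y * - r y - - B y"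
    using assms by (intro delta_le_of_mono_on[where a = a]) (auto intro!: derivative_eq_intros)
  then show ?thesis by simp
qed

section \<open>One-sided limits of monotone functions\<close>

text \<open>Near \<open>u\<close> the values of \<open>d\<close> lie below any fixed
  \<open>d q\<close>, so a limit bounds \<open>d q\<close> from below. Conversely, nonnegativity
  bounds \<open>d\<close> below (\<open>K = 0\<close>), so the limit exists and is the real
  infimum.\<close>

lemma mono_on_at_right_limit_nonneg_iff:
  fixes d :: "real \<Rightarrow> real"
  assumes "u < v" and mono: "mono_on {u<..v} d"
  shows "(\<exists>L. ((\<lambda>q. ereal (d q)) \<longlongrightarrow> L) (at_right u) \<and> L \<ge> 0) \<longleftrightarrow> (\<forall>q\<in>{u<..v}. 0 \<le> d q)"
proof (intro iffI ballI)
  fix q assume "\<exists>L. ((\<lambda>q. ereal (d q)) \<longlongrightarrow> L) (at_right u) \<and> L \<ge> 0" and q: "q \<in> {u<..v}"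
  then obtain L where L: "((\<lambda>q. ereal (d q)) \<longlongrightarrow> L) (at_right u)" "L \<ge> 0" by blast
  have "eventually (\<lambda>x. x \<in> {u<..<q}) (at_right u)"
    using q by (intro eventually_at_right_real) auto
  then have "eventually (\<lambda>x. ereal (d x) \<le> ereal (d q)) (at_right u)"
    by eventually_elim (use q in \<open>auto intro!: mono_onD[OF mono]\<close>)
  then have "L \<le> ereal (d q)"
    by (intro tendsto_upperbound[OF L(1)]) auto
  then show "0 \<le> d q" using L(2) by (metis ereal_less_eq(5) order_trans)
next
  assume nn: "\<forall>q\<in>{u<..v}. 0 \<le> d q"
  let ?I = "{u<..v}"
  have I: "{u<..} \<inter> ?I = ?I" by auto
  have at: "at u within ?I = at_right u"
    using \<open>u < v\<close> by (intro at_within_nhd[of _ "{..<v}"]) auto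
  have "(d \<longlongrightarrow> Inf (d ` ({u<..} \<inter> ?I))) (at u within ({u<..} \<inter> ?I))"
    using mono nn by (intro Lim_right_bound[where K = 0]) (auto intro: mono_onD)
  then have "(d \<longlongrightarrow> Inf (d ` ?I)) (at_right u)"
    by (simp only: I at)
  moreover have "0 \<le> Inf (d ` ?I)"
    using nn \<open>u < v\<close> by (intro cInf_greatest) auto
  ultimately show "\<exists>L. ((\<lambda>q. ereal (d q)) \<longlongrightarrow> L) (at_right u) \<and> L \<ge> 0"
    by (intro exI[of _ "ereal (Inf (d ` ?I))"]) auto
qed

text \<open>The mirror argument: the limit at \<open>v\<close> is the supremum, finite because
  \<open>d\<close> is bounded above by 0.\<close>

lemma mono_on_at_left_limit_nonpos_iff:
  fixes d :: "real \<Rightarrow> real"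
  assumes "u < v" and mono: "mono_on {u..<v} d"
  shows "(\<exists>L. ((\<lambda>q. ereal (d q)) \<longlongrightarrow> L) (at_left v) \<and> L \<le> 0) \<longleftrightarrow> (\<forall>q\<in>{u..<v}. d q \<le> 0)"
proof (intro iffI ballI)
  fix q assume "\<exists>L. ((\<lambda>q. ereal (d q)) \<longlongrightarrow> L) (at_left v) \<and> L \<le> 0" and q: "q \<in> {u..<v}"
  then obtain L where L: "((\<lambda>q. ereal (d q)) \<longlongrightarrow> L) (at_left v)" "L \<le> 0" by blast
  have "eventually (\<lambda>x. x \<in> {q<..<v}) (at_left v)"
    using q by (intro eventually_at_left_real) auto
  then have "eventually (\<lambda>x. ereal (d q) \<le> ereal (d x)) (at_left v)"
    by eventually_elim (use q in \<open>auto intro!: mono_onD[OF mono]\<close>)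
  then have "ereal (d q) \<le> L"
    by (intro tendsto_lowerbound[OF L(1)]) auto
  then show "d q \<le> 0" using L(2) by (metis ereal_less_eq(4) order_trans)
next
  assume np: "\<forall>q\<in>{u..<v}. d q \<le> 0"
  let ?I = "{u..<v}"
  have I: "{..<v} \<inter> ?I = ?I" by auto
  have at: "at v within ?I = at_left v"
    using \<open>u < v\<close> by (intro at_within_nhd[of _ "{u<..}"]) auto
  have "(d \<longlongrightarrow> Sup (d ` ({..<v} \<inter> ?I))) (at v within ({..<v} \<inter> ?I))"
    using mono np by (intro Lim_left_bound[where K = 0]) (auto intro: mono_onD)
  then have "(d \<longlongrightarrow> Sup (d ` ?I)) (at_left v)"
    by (simp only: I at)
  moreover have "Sup (d ` ?I) \<le> 0"
    using np \<open>u < v\<close> by (intro cSup_least) auto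
  ultimately show "\<exists>L. ((\<lambda>q. ereal (d q)) \<longlongrightarrow> L) (at_left v) \<and> L \<le> 0"
    by (intro exI[of _ "ereal (Sup (d ` ?I))"]) auto
qed

lemma antimono_on_at_left_limit_nonneg_iff:
  fixes d :: "real \<Rightarrow> real"
  assumes "u < v" and anti: "antimono_on {u..<v} d"
  shows "(\<exists>L. ((\<lambda>q. ereal (d q)) \<longlongrightarrow> L) (at_left v) \<and> L \<ge> 0) \<longleftrightarrow> (\<forall>q\<in>{u..<v}. 0 \<le> d q)"
proof -
  have "mono_on {u..<v} (\<lambda>q. - d q)"
    using anti by (auto simp: monotone_on_def)
  note iff = mono_on_at_left_limit_nonpos_iff[OF \<open>u < v\<close> this]
  have "(\<exists>L. ((\<lambda>q. ereal (d q)) \<longlongrightarrow> L) (at_left v) \<and> L \<ge> 0) \<longleftrightarrow>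
        (\<exists>L. ((\<lambda>q. ereal (- d q)) \<longlongrightarrow> L) (at_left v) \<and> L \<le> 0)" (is "?P \<longleftrightarrow> ?Q")
  proof
    assume ?P
    then obtain L where "((\<lambda>q. ereal (d q)) \<longlongrightarrow> L) (at_left v)" "L \<ge> 0" by blast
    then show ?Q
      using tendsto_uminus_ereal[of "\<lambda>q. ereal (d q)" L] by (intro exI[of _ "- L"]) auto
  next
    assume ?Q
    then obtain L where "((\<lambda>q. ereal (- d q)) \<longlongrightarrow> L) (at_left v)" "L \<le> 0" by blast
    then show ?P
      using tendsto_uminus_ereal[of "\<lambda>q. ereal (- d q)" L] by (intro exI[of _ "- L"]) auto
  qed
  then show ?thesis using iff by simp
qed

section \<open>Sign of a function that alternates between breakpoints\<close>

lemma ex_consecutive_bounds: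
  fixes b :: "nat \<Rightarrow> 'a::linorder"
  assumes "b 0 \<le> q" and "q < b (Suc n)"
  shows "\<exists>i\<le>n. b i \<le> q \<and> q < b (Suc i)"
  using assms(2)
proof (induction n)
  case 0
  then show ?case using assms(1) by auto
next
  case (Suc n)
  then show ?case by (cases "q < b (Suc n)") (auto intro: le_SucI)
qed

text \<open>Isolates what the sign analysis needs of delta. The pieces are closed up to 0 and 1, so
  neighbouring pieces share their breakpoint and its value bounds \<open>d\<close> on both of
  them.\<close>

locale alternating =
  fixes d :: "real \<Rightarrow> real" and b :: "nat \<Rightarrow> real" and n :: nat
  assumes n_pos: "1 \<le> n"
    and first: "b 0 = 0" and last: "b (Suc n) = 1"
    and less: "\<And>i. i \<le> n \<Longrightarrow> b i < b (Suc i)"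
    and interior: "\<And>i. i \<in> {1..n} \<Longrightarrow> b i \<in> {0<..<1}"
    and incr: "\<And>i. i \<le> n \<Longrightarrow> even i \<Longrightarrow> mono_on ({b i..b (Suc i)} \<inter> {0<..<1}) d"
    and decr: "\<And>i. i \<le> n \<Longrightarrow> odd i \<Longrightarrow> antimono_on ({b i..b (Suc i)} \<inter> {0<..<1}) d"
begin

lemma mono_first: "mono_on {0<..b 1} d"
proof -
  have "{b 0..b (Suc 0)} \<inter> {0<..<1} = {0<..b 1}"
    using first interior[of 1] n_pos by auto
  then show ?thesis using incr[of 0] by simp
qed

lemma last_piece: "{b n..b (Suc n)} \<inter> {0<..<1} = {b n..<1}"
  using last interior[of n] n_pos by auto

text \<open>Only the lower ends of the pieces matter. An increasing piece is lowest at its left end,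
  which is 0 or an even breakpoint; a decreasing piece at its right end, which is an even
  breakpoint, or 1 when \<open>n\<close> is odd. At 0 and 1 a limit replaces the value.\<close>

lemma nonneg_iff:
  "(\<forall>q\<in>{0<..<1}. 0 \<le> d q) \<longleftrightarrow>
     (\<exists>L. ((\<lambda>q. ereal (d q)) \<longlongrightarrow> L) (at_right 0) \<and> L \<ge> 0) \<and>
     (\<forall>i\<in>{1..n}. even i \<longrightarrow> 0 \<le> d (b i)) \<and>
     (odd n \<longrightarrow> (\<exists>L. ((\<lambda>q. ereal (d q)) \<longlongrightarrow> L) (at_left 1) \<and> L \<ge> 0))"
proof -
  have bn: "0 < b 1" "b 1 < 1" "0 < b n" "b n < 1"
    using interior[of 1] interior[of n] n_pos by auto
  have lim0: "(\<exists>L. ((\<lambda>q. ereal (d q)) \<longlongrightarrow> L) (at_right 0) \<and> L \<ge> 0) \<longleftrightarrow> (\<forall>q\<in>{0<..b 1}. 0 \<le> d q)"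
    by (rule mono_on_at_right_limit_nonneg_iff[OF bn(1) mono_first])
  have lim1: "(\<exists>L. ((\<lambda>q. ereal (d q)) \<longlongrightarrow> L) (at_left 1) \<and> L \<ge> 0) \<longleftrightarrow> (\<forall>q\<in>{b n..<1}. 0 \<le> d q)"
    if "odd n"
    by (rule antimono_on_at_left_limit_nonneg_iff[OF bn(4)])
       (use decr[OF order_refl that] last_piece in simp)
  show ?thesis
  proof (intro iffI conjI impI ballI)
    assume nn: "\<forall>q\<in>{0<..<1}. 0 \<le> d q"
    show "\<exists>L. ((\<lambda>q. ereal (d q)) \<longlongrightarrow> L) (at_right 0) \<and> L \<ge> 0"
      unfolding lim0 using nn bn by auto
    show "0 \<le> d (b i)" if "i \<in> {1..n}" for i
      using nn interior[OF that] by blast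
    show "\<exists>L. ((\<lambda>q. ereal (d q)) \<longlongrightarrow> L) (at_left 1) \<and> L \<ge> 0" if "odd n"
      unfolding lim1[OF that] using nn bn by auto
  next
    fix q :: real
    assume *: "(\<exists>L. ((\<lambda>q. ereal (d q)) \<longlongrightarrow> L) (at_right 0) \<and> L \<ge> 0) \<and>
       (\<forall>i\<in>{1..n}. even i \<longrightarrow> 0 \<le> d (b i)) \<and>
       (odd n \<longrightarrow> (\<exists>L. ((\<lambda>q. ereal (d q)) \<longlongrightarrow> L) (at_left 1) \<and> L \<ge> 0))"
      and q: "q \<in> {0<..<1}"
    from * have initial: "\<forall>q\<in>{0<..b 1}. 0 \<le> d q"
      and even: "\<And>i. i \<in> {1..n} \<Longrightarrow> even i \<Longrightarrow> 0 \<le> d (b i)"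
      and final: "odd n \<Longrightarrow> \<forall>q\<in>{b n..<1}. 0 \<le> d q"
      using lim0 lim1 by blast+
    obtain i where i: "i \<le> n" "b i \<le> q" "q < b (Suc i)"
      using ex_consecutive_bounds[of b q n] q first last by auto
    \<comment> \<open>The cases say where the piece containing \<open>q\<close> is lowest: the limit
      at 0, the breakpoint \<open>i\<close>, the limit at 1, or the breakpoint
      \<open>Suc i\<close>.\<close>
    consider "i = 0" | "even i" "i \<in> {1..n}" | "odd i" "i = n" | "odd i" "Suc i \<in> {1..n}"
      using i(1) by (metis Suc_leI Suc_le_mono atLeastAtMost_iff le_neq_implies_less One_nat_def le0 not0_implies_Suc even_zero)
    then show "0 \<le> d q"
    proof cases
      case 1
      then show ?thesis using initial q i by simp
    next
      case 2
      then have "d (b i) \<le> d q"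
        using i q interior[OF 2(2)] by (intro mono_onD[OF incr[OF i(1)]]) auto
      then show ?thesis using even[OF 2(2,1)] by linarith
    next
      case 3
      then show ?thesis using final q i by simp
    next
      case 4
      then have "d (b (Suc i)) \<le> d q"
        using i q interior[OF 4(2)] by (intro monotone_onD[OF decr[OF i(1)]]) auto
      then show ?thesis using even[OF 4(2)] 4(1) by simp
    qed
  qed
qed

text \<open>Now the upper ends decide: the right end of an increasing piece and the left end of a
  decreasing one. These are the odd breakpoints, together with 1 when \<open>n\<close> is even. The
  first piece increases, so 0 contributes no condition.\<close>

lemma nonpos_iff:
  "(\<forall>q\<in>{0<..<1}. d q \<le> 0) \<longleftrightarrow>
     (\<forall>i\<in>{1..n}. odd i \<longrightarrow> d (b i) \<le> 0) \<and>
     (even n \<longrightarrow> (\<exists>L. ((\<lambda>q. ereal (d q)) \<longlongrightarrow> L) (at_left 1) \<and> L \<le> 0))"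
proof -
  have bn: "0 < b n" "b n < 1"
    using interior[of n] n_pos by auto
  have lim1: "(\<exists>L. ((\<lambda>q. ereal (d q)) \<longlongrightarrow> L) (at_left 1) \<and> L \<le> 0) \<longleftrightarrow> (\<forall>q\<in>{b n..<1}. d q \<le> 0)"
    if "even n"
    by (rule mono_on_at_left_limit_nonpos_iff[OF bn(2)])
       (use incr[OF order_refl that] last_piece in simp)
  show ?thesis
  proof (intro iffI conjI impI ballI)
    assume np: "\<forall>q\<in>{0<..<1}. d q \<le> 0"
    show "d (b i) \<le> 0" if "i \<in> {1..n}" for i
      using np interior[OF that] by blast
    show "\<exists>L. ((\<lambda>q. ereal (d q)) \<longlongrightarrow> L) (at_left 1) \<and> L \<le> 0" if "even n"
      unfolding lim1[OF that] using np bn by auto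
  next
    fix q :: real
    assume *: "(\<forall>i\<in>{1..n}. odd i \<longrightarrow> d (b i) \<le> 0) \<and>
       (even n \<longrightarrow> (\<exists>L. ((\<lambda>q. ereal (d q)) \<longlongrightarrow> L) (at_left 1) \<and> L \<le> 0))"
      and q: "q \<in> {0<..<1}"
    from * have odd: "\<And>i. i \<in> {1..n} \<Longrightarrow> odd i \<Longrightarrow> d (b i) \<le> 0"
      and final: "even n \<Longrightarrow> \<forall>q\<in>{b n..<1}. d q \<le> 0"
      using lim1 by blast+
    obtain i where i: "i \<le> n" "b i \<le> q" "q < b (Suc i)"
      using ex_consecutive_bounds[of b q n] q first last by auto
    consider "even i" "i = n" | "even i" "Suc i \<in> {1..n}" | "odd i" "i \<in> {1..n}"
      using i(1) by (metis Suc_leI Suc_le_mono atLeastAtMost_iff le_neq_implies_less One_nat_def le0 not0_implies_Suc even_zero)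
    then show "d q \<le> 0"
    proof cases
      case 1
      then show ?thesis using final q i by simp
    next
      case 2
      then have "d q \<le> d (b (Suc i))"
        using i q interior[OF 2(2)] by (intro mono_onD[OF incr[OF i(1)]]) auto
      then show ?thesis using odd[OF 2(2)] 2(1) by simp
    next
      case 3
      then have "d q \<le> d (b i)"
        using i q interior[OF 3(2)] by (intro monotone_onD[OF decr[OF i(1)]]) auto
      then show ?thesis using odd[OF 3(2,1)] by linarith
    qed
  qed
qed

end

section \<open>Positivity of the quantile function\<close>

context nonneg_random_variable
begin

lemma quantile_nonneg:
  assumes "p \<in> {0<..<1}"
  shows "0 \<le> quantile M X p"
proof -
  have X [measurable]: "X \<in> borel_measurable M"
    using finite_expectation by auto
  interpret D: real_distribution "distr M borel X"
    by (rule real_distribution_distr) simp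
  \<comment> \<open>The set in the definition of the quantile must be nonempty for its
    \<open>Inf\<close> to be meaningful; this holds because the distribution function tends to 1 and
    \<open>p < 1\<close>.\<close>
  have "eventually (\<lambda>x. p < cdf (distr M borel X) x) at_top"
    using D.cdf_lim_at_top_prob assms by (auto dest: order_tendstoD(1))
  then obtain x where "p < cdf (distr M borel X) x"
    by (metis eventually_at_top_linorder order_refl)
  then have "{x. p \<le> cdf (distr M borel X) x} \<noteq> {}"
    by (auto intro: less_imp_le)
  moreover have "0 \<le> x" if "p \<le> cdf (distr M borel X) x" for x
  proof (rule ccontr)
    assume "\<not> 0 \<le> x"
    then have "AE \<omega> in M. \<not> X \<omega> \<le> x"
      using nonneg by (auto elim: eventually_mono)
    then have "prob {\<omega> \<in> space M. X \<omega> \<le> x} = 0"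
      by (intro prob_eq_0[THEN iffD2]) auto
    moreover have "cdf (distr M borel X) x = prob {\<omega> \<in> space M. X \<omega> \<le> x}"
      by (simp add: cdf_def measure_distr vimage_def Int_def conj_commute)
    ultimately show False using that assms by simp
  qed
  ultimately show ?thesis
    unfolding quantile_def by (intro cInf_greatest) auto
qed

text \<open>The derivative is positive, so the quantile at \<open>p\<close> strictly exceeds the
  nonnegative one at \<open>p / 2\<close>.\<close>

lemma quantile_pos:
  assumes "p \<in> {0<..<1}"
  shows "0 < quantile M X p"
proof -
  have "p / 2 < p" using assms by simp
  then have "quantile M X (p / 2) < quantile M X p"
  proof (rule DERIV_pos_imp_increasing)
    show "\<exists>w. (quantile M X has_real_derivative w) (at t) \<and> 0 < w"
      if "p / 2 \<le> t" "t \<le> p" for t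
      using that assms density_quantile_pos[of t]
      by (intro exI[of _ "1 / f (quantile M X t)"] conjI quantile_derivative) auto
  qed
  then show ?thesis using quantile_nonneg[of "p / 2"] assms by simp
qed

end

section \<open>Both star-shaped orders in terms of the modes of the ratio\<close>

theorem corollary2p2:
  fixes M :: "'a measure" and N :: "'b measure"
    and X :: "'a \<Rightarrow> real" and Y :: "'b \<Rightarrow> real"
    and f g :: "real \<Rightarrow> real" and lX uX lY uY :: ereal
    and n :: nat and p :: "nat \<Rightarrow> real"
  assumes "nonneg_random_variable M X f lX uX"
    and "nonneg_random_variable N Y g lY uY"
    and "n \<ge> 1"
    and "has_modes_initially_increasing (density_quantile_ratio M X f N Y g) n p"
  shows
    "(star_le M X N Y \<longleftrightarrow>
       (\<exists>m. n = 2 * m \<and>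
          (\<exists>L. ((\<lambda>q. ereal (delta M X f N Y g q)) \<longlongrightarrow> L) (at_right 0) \<and> L \<ge> 0) \<and>
          (\<forall>i\<in>{1..m}. delta M X f N Y g (p (2 * i)) \<ge> 0)) \<or>
       (\<exists>m. n = 2 * m + 1 \<and>
          (\<exists>L. ((\<lambda>q. ereal (delta M X f N Y g q)) \<longlongrightarrow> L) (at_right 0) \<and> L \<ge> 0) \<and>
          (\<forall>i\<in>{1..m}. delta M X f N Y g (p (2 * i)) \<ge> 0) \<and>
          (\<exists>L. ((\<lambda>q. ereal (delta M X f N Y g q)) \<longlongrightarrow> L) (at_left 1) \<and> L \<ge> 0))) \<and>
     (star_le N Y M X \<longleftrightarrow>
       (\<exists>m. n = 2 * m \<and>
          (\<exists>L. ((\<lambda>q. ereal (delta M X f N Y g q)) \<longlongrightarrow> L) (at_left 1) \<and> L \<le> 0) \<and>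
          (\<forall>i\<in>{1..m}. delta M X f N Y g (p (2 * i - 1)) \<le> 0)) \<or>
       (\<exists>m. n = 2 * m + 1 \<and>
          (\<forall>i\<in>{1..m + 1}. delta M X f N Y g (p (2 * i - 1)) \<le> 0)))"
proof -
  interpret X: nonneg_random_variable M X f lX uX by fact
  interpret Y: nonneg_random_variable N Y g lY uY by fact
  define A where "A = quantile M X"
  define B where "B = quantile N Y"
  define a where "a t = 1 / f (A t)" for t
  define r where "r = density_quantile_ratio M X f N Y g"
  define d where "d = delta M X f N Y g"
  define b where "b = breakpoint n p"
  have d_eq: "d t = A t * r t - B t" for t
    by (simp add: d_def delta_def A_def B_def r_def)
  have A: "(A has_real_derivative a t) (at t)" and a: "0 < a t" and A_pos: "0 < A t"
    and B: "(B has_real_derivative a t * r t) (at t)" and B_pos: "0 < B t"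
    if t: "t \<in> {0<..<1}" for t
  proof -
    have "0 < f (A t)" using X.density_quantile_pos[OF t] by (simp add: A_def)
    then show "0 < a t" by (simp add: a_def)
    show "(A has_real_derivative a t) (at t)"
      using X.quantile_derivative[OF t] by (simp add: A_def a_def)
    show "0 < A t" "0 < B t"
      using X.quantile_pos[OF t] Y.quantile_pos[OF t] by (simp_all add: A_def B_def)
    \<comment> \<open>This is \<open>B' = A' * r\<close>; positivity of \<open>f (A t)\<close> lets
      it cancel in the product.\<close>
    have "1 / g (B t) = a t * r t"
      using \<open>0 < f (A t)\<close> by (simp add: a_def r_def density_quantile_ratio_def A_def B_def)
    then show "(B has_real_derivative a t * r t) (at t)"
      using Y.quantile_derivative[OF t] by (simp add: B_def)
  qed
  have modes: "strict_mono_on {1..n} p" "p ` {1..n} \<subseteq> {0<..<1}"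
    and mono: "\<And>i. i \<le> n \<Longrightarrow> even i \<Longrightarrow> mono_on {b i<..<b (Suc i)} r"
    and anti: "\<And>i. i \<le> n \<Longrightarrow> odd i \<Longrightarrow> antimono_on {b i<..<b (Suc i)} r"
    using assms(4) unfolding has_modes_initially_increasing_def r_def b_def by auto
  have b_eq: "b i = p i" if "i \<in> {1..n}" for i
    using that by (simp add: b_def breakpoint_def)
  interpret alternating d b n
  proof
    show "1 \<le> n" by fact
    show "b 0 = 0" "b (Suc n) = 1" by (simp_all add: b_def breakpoint_def)
    show "b i \<in> {0<..<1}" if "i \<in> {1..n}" for i
      unfolding b_eq[OF that] using modes(2) imageI[OF that, of p] by (rule subsetD)
    show "b i < b (Suc i)" if "i \<le> n" for i
    proof -
      have "0 < p (Suc 0)" "p n < 1"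
        using modes(2) \<open>1 \<le> n\<close> by (auto simp: image_subset_iff)
      moreover have "p i < p (Suc i)" if "i \<noteq> 0" "i \<noteq> n"
        using that \<open>i \<le> n\<close> by (intro strict_mono_onD[OF modes(1)]) auto
      ultimately show ?thesis
        using \<open>i \<le> n\<close> \<open>1 \<le> n\<close> by (cases "i = n") (auto simp: b_def breakpoint_def)
    qed
    show "mono_on ({b i..b (Suc i)} \<inter> {0<..<1}) d" if i: "i \<le> n" "even i" for i
    proof (rule mono_onI)
      fix x y assume *: "x \<in> {b i..b (Suc i)} \<inter> {0<..<1}"
        "y \<in> {b i..b (Suc i)} \<inter> {0<..<1}" "x \<le> y"
      show "d x \<le> d y"
      proof (cases "x = y")
        case False
        \<comment> \<open>Even if \<open>x\<close> or \<open>y\<close> is a breakpoint, the open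
          interval between them lies inside the open piece on which \<open>r\<close> is
          monotone.\<close>
        have "mono_on {x<..<y} r"
          using * by (intro mono_on_subset[OF mono[OF i]]) auto
        then show ?thesis
          unfolding d_eq using * False A_pos[of x]
          by (intro delta_le_of_mono_on[where a = a] A B a) auto
      qed simp
    qed
    show "antimono_on ({b i..b (Suc i)} \<inter> {0<..<1}) d" if i: "i \<le> n" "odd i" for i
    proof (rule monotone_onI)
      fix x y assume *: "x \<in> {b i..b (Suc i)} \<inter> {0<..<1}"
        "y \<in> {b i..b (Suc i)} \<inter> {0<..<1}" "x \<le> y"
      show "d y \<le> d x"
      proof (cases "x = y")
        case False
        have "antimono_on {x<..<y} r"
          using * by (intro monotone_on_subset[OF anti[OF i]]) auto
        then show ?thesis
          unfolding d_eq using * False A_pos[of x]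
          by (intro delta_ge_of_antimono_on[where a = a] A B a) auto
      qed simp
    qed
  qed
  \<comment> \<open>The numerator of the derivative of \<open>B / A\<close> is \<open>a * d\<close>,
    and that of \<open>A / B\<close> is its negative. Since \<open>a\<close> is positive, the sign
    of \<open>d\<close> settles both orders.\<close>
  have d_sign: "A t * (a t * r t) - B t * a t = a t * d t" for t
    by (simp add: d_eq algebra_simps)
  have XY: "star_le M X N Y \<longleftrightarrow> (\<forall>t\<in>{0<..<1}. 0 \<le> d t)"
  proof -
    have "star_le M X N Y \<longleftrightarrow> (\<forall>t\<in>{0<..<1}. B t * a t \<le> A t * (a t * r t))"
      unfolding star_le_def A_def[symmetric] B_def[symmetric]
      by (rule mono_on_divide_iff[OF A B A_pos])
    also have "\<dots> \<longleftrightarrow> (\<forall>t\<in>{0<..<1}. 0 \<le> a t * d t)"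
      by (simp flip: d_sign)
    also have "\<dots> \<longleftrightarrow> (\<forall>t\<in>{0<..<1}. 0 \<le> d t)"
      by (intro ball_cong refl) (metis a mult_le_cancel_left_pos mult_zero_right)
    finally show ?thesis .
  qed
  have YX: "star_le N Y M X \<longleftrightarrow> (\<forall>t\<in>{0<..<1}. d t \<le> 0)"
  proof -
    have "star_le N Y M X \<longleftrightarrow> (\<forall>t\<in>{0<..<1}. A t * (a t * r t) \<le> B t * a t)"
      unfolding star_le_def A_def[symmetric] B_def[symmetric]
      by (rule mono_on_divide_iff[OF B A B_pos])
    also have "\<dots> \<longleftrightarrow> (\<forall>t\<in>{0<..<1}. a t * d t \<le> 0)"
      by (simp flip: d_sign)
    also have "\<dots> \<longleftrightarrow> (\<forall>t\<in>{0<..<1}. d t \<le> 0)"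
      by (intro ball_cong refl) (metis a mult_le_cancel_left_pos mult_zero_right)
    finally show ?thesis .
  qed
  have even_index: "(\<forall>i\<in>{1..n}. even i \<longrightarrow> P (b i)) \<longleftrightarrow> (\<forall>i\<in>{1..m}. P (p (2 * i)))"
    if "n = 2 * m \<or> n = 2 * m + 1" for P m
  proof (intro iffI ballI impI)
    fix i assume *: "\<forall>i\<in>{1..n}. even i \<longrightarrow> P (b i)" "i \<in> {1..m}"
    then have i: "2 * i \<in> {1..n}" using that by auto
    then show "P (p (2 * i))" using bspec[OF *(1) i] b_eq[OF i] by simp
  next
    fix i assume *: "\<forall>i\<in>{1..m}. P (p (2 * i))" "i \<in> {1..n}" "even i"
    then obtain k where k: "i = 2 * k" by (auto elim: evenE)
    then have "k \<in> {1..m}" using that * by auto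
    then show "P (b i)" using bspec[OF *(1)] b_eq[OF *(2)] k by simp
  qed
  \<comment> \<open>Here \<open>m\<close> counts the odd indices up to \<open>n\<close>, so an odd
    \<open>n = 2 * m + 1\<close> is treated below with \<open>m + 1\<close>. The natural subtraction
    does not truncate because \<open>i\<close> starts at 1.\<close>
  have odd_index: "(\<forall>i\<in>{1..n}. odd i \<longrightarrow> P (b i)) \<longleftrightarrow> (\<forall>i\<in>{1..m}. P (p (2 * i - 1)))"
    if "n = 2 * m \<or> n + 1 = 2 * m" for P m
  proof (intro iffI ballI impI)
    fix i assume *: "\<forall>i\<in>{1..n}. odd i \<longrightarrow> P (b i)" "i \<in> {1..m}"
    then have i: "odd (2 * i - 1)" "2 * i - 1 \<in> {1..n}" using that by auto
    then show "P (p (2 * i - 1))" using bspec[OF *(1) i(2)] b_eq[OF i(2)] by simp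
  next
    fix i assume *: "\<forall>i\<in>{1..m}. P (p (2 * i - 1))" "i \<in> {1..n}" "odd i"
    then obtain k where k: "i = 2 * k + 1" by (auto elim: oddE)
    then have "Suc k \<in> {1..m}" using that * by auto
    then have "P (p (2 * Suc k - 1))" using * by blast
    then show "P (b i)" using b_eq[OF *(2)] k by simp
  qed
  show ?thesis
  proof (cases "even n")
    case True
    then obtain m where m: "n = 2 * m" by (auto elim: evenE)
    \<comment> \<open>Parity leaves one of the two disjuncts and fixes its witness; the same happens
      for odd \<open>n\<close>.\<close>
    have ex: "(\<exists>k. n = 2 * k \<and> P k) \<longleftrightarrow> P m" "(\<exists>k. n = 2 * k + 1 \<and> P k) \<longleftrightarrow> False" for P
      unfolding m by (auto, presburger)
    show ?thesis
      unfolding XY YX nonneg_iff nonpos_iff ex d_def[symmetric]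
        even_index[of m "\<lambda>x. 0 \<le> d x", OF disjI1[OF m]]
        odd_index[of m "\<lambda>x. d x \<le> 0", OF disjI1[OF m]]
      using True by (simp add: conj_commute)
  next
    case False
    then obtain m where m: "n = 2 * m + 1" by (auto elim: oddE)
    then have m': "n + 1 = 2 * (m + 1)" by simp
    have ex: "(\<exists>k. n = 2 * k + 1 \<and> P k) \<longleftrightarrow> P m" "(\<exists>k. n = 2 * k \<and> P k) \<longleftrightarrow> False" for P
      unfolding m by (auto, presburger)
    show ?thesis
      unfolding XY YX nonneg_iff nonpos_iff ex d_def[symmetric]
        even_index[of m "\<lambda>x. 0 \<le> d x", OF disjI2[OF m]]
        odd_index[of "m + 1" "\<lambda>x. d x \<le> 0", OF disjI2[OF m']]
      using False by (simp add: conj_commute)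
  qed
qed

end
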